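(* Let $\mathcal A$ be an alphabet containing at least two letters and let $v\in\mathcal A^*$. The epistandard morphism $\mu_v$ is strongly quasiperiodic on $\mathcal A$ if and only if $\mathrm{Alph}(v)=\mathcal A$. Moreover, when $\mathrm{Alph}(v)=\mathcal A$, $Pal(v)$ is a quasiperiod of $\mu_v(\mathbf w)$ for every infinite word $\mathbf w$ over $\mathcal A$.
   Context: $\mathrm{Alph}(u)$ is the set of letters of $u$. For $a\in\mathcal A$, $L_a$ is the morphism with $L_a(a)=a$, $L_a(b)=ab$ for $b\ne a$; for $v=x_1\cdots x_n$, $\mu_v=L_{x_1}\circ\cdots\circ L_{x_n}$ ($\mu_\varepsilon$ the identity), extended letterwise to infinite words. $Pal$: $Pal(\varepsilon)=\varepsilon$, $Pal(ux)$ is the shortest palindrome having $Pal(u)x$ as a prefix. A finite word $u$ is a quasiperiod of an infinite word $\mathbf w$ if there are words $p_n$ ($n\ge0$) with $p_0=\varepsilon$, $|p_n|<|p_{n+1}|\le|p_nu|$ and $p_nu$ a prefix of $\mathbf w$; $\mathbf w$ is quasiperiodic if it has a quasiperiod. A morphism $f$ on $\mathcal A$ is strongly quasiperiodic if $f(\mathbf w)$ is quasiperiodic for every infinite word $\mathbf w$ over $\mathcal A$. *)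

theory Defs
  imports "HOL-Library.Stream" "HOL-Library.Sublist"
begin

definition L :: "'a \<Rightarrow> 'a list \<Rightarrow> 'a list" where
  "L a u = concat (map (\<lambda>b. if b = a then [a] else [a, b]) u)"

primrec mu :: "'a list \<Rightarrow> 'a list \<Rightarrow> 'a list" where
  "mu [] = id"
| "mu (x # v) = L x \<circ> mu v"

text \<open>Letterwise extension of a morphism to infinite words. As \<^const>\<open>flat\<close> is
  meaningful only for streams of nonempty lists, this is the usual extension only when
  no letter of the word is erased.\<close>

definition inf_image :: "('a list \<Rightarrow> 'b list) \<Rightarrow> 'a stream \<Rightarrow> 'b stream" where
  "inf_image f w = flat (smap (\<lambda>a. f [a]) w)"

text \<open>The shortest palindrome with prefix \<open>w\<close> is unique: its length is at most twice that of
  \<open>w\<close>, and a palindrome of such a length is determined by its length and its prefix \<open>w\<close>.\<close>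

definition pal_closure :: "'a list \<Rightarrow> 'a list" where
  "pal_closure w = (ARG_MIN length p. rev p = p \<and> prefix w p)"

definition Pal :: "'a list \<Rightarrow> 'a list" where
  "Pal v = foldl (\<lambda>p x. pal_closure (p @ [x])) [] v"

definition inf_prefix :: "'a list \<Rightarrow> 'a stream \<Rightarrow> bool" where
  "inf_prefix u w \<longleftrightarrow> (\<exists>w'. w = u @- w')"

definition quasiperiod :: "'a list \<Rightarrow> 'a stream \<Rightarrow> bool" where
  "quasiperiod u w \<longleftrightarrow>
     (\<exists>p :: nat \<Rightarrow> 'a list. p 0 = [] \<and>
        (\<forall>n. length (p n) < length (p (Suc n)) \<and>
             length (p (Suc n)) \<le> length (p n @ u) \<and>
             inf_prefix (p n @ u) w))"

definition quasiperiodic :: "'a stream \<Rightarrow> bool" where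
  "quasiperiodic w \<longleftrightarrow> (\<exists>u. quasiperiod u w)"

text \<open>The first conjunct keeps \<^const>\<open>inf_image\<close> within its intended domain and loses nothing:
  a morphism erasing a letter \<open>a\<close> maps the infinite word \<open>aaa...\<close> to the empty word, which is
  not a quasiperiodic infinite word.\<close>

definition strongly_quasiperiodic :: "'a set \<Rightarrow> ('a list \<Rightarrow> 'b list) \<Rightarrow> bool" where
  "strongly_quasiperiodic A f \<longleftrightarrow>
     (\<forall>a\<in>A. f [a] \<noteq> []) \<and> (\<forall>w\<in>streams A. quasiperiodic (inf_image f w))"

end

theory Submission
  imports Defs "HOL-Library.Multiset"
begin

text \<open>Of any two consecutive letters of \<open>L\<^sub>y (u) y x\<close> one is \<open>y\<close>, and this property passes to the
  shortest palindrome starting with that word. Hence that palindrome is \<open>L\<^sub>y (q) y\<close> for a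
  palindrome \<open>q\<close> starting with \<open>u x\<close>. The shortest such \<open>q\<close> also contains each letter least
  often, which makes \<open>L\<^sub>y (q) y\<close> shortest as well. Adding one letter \<open>x\<close> after the other, one
  obtains Justin's formula \<open>Pal (y v) = L\<^sub>y (Pal v) y\<close>.

  By that formula, \<open>Pal v\<close> is a prefix of every \<open>\<mu>\<^sub>v (w)\<close>, and \<open>\<mu>\<^sub>v (a)\<close> is a prefix of
  \<open>Pal v\<close> for each letter \<open>a\<close> of \<open>v\<close>. So if all letters occur in \<open>v\<close>, the occurrences of
  \<open>Pal v\<close> at the block boundaries of \<open>\<mu>\<^sub>v (w)\<close> cover it. Conversely, each letter of a
  quasiperiodic word recurs, so if \<open>f\<close> is strongly quasiperiodic, then quasiperiodicity of
  \<open>f (a b b b ...)\<close> forces each letter of \<open>f (a)\<close> to occur in \<open>f (b)\<close>. For \<open>f = \<mu>\<^sub>v\<close> and a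
  letter \<open>a\<close> that is not in \<open>v\<close>, this fails as soon as \<open>b \<noteq> a\<close>.\<close>

section \<open>Quasiperiodic words\<close>

lemma inf_prefix_iff_stake: "inf_prefix u w \<longleftrightarrow> stake (length u) w = u"
proof
  assume "stake (length u) w = u"
  then show "inf_prefix u w"
    unfolding inf_prefix_def by (metis stake_sdrop)
qed (auto simp: inf_prefix_def stake_shift)

lemma inf_prefix_append_iff:
  "inf_prefix (u @ v) w \<longleftrightarrow> inf_prefix u w \<and> inf_prefix v (sdrop (length u) w)"
  by (simp add: inf_prefix_iff_stake flip: stake_add)

lemma quasiperiod_iff_occurrences:
  "quasiperiod u w \<longleftrightarrow>
     (\<exists>i :: nat \<Rightarrow> nat. i 0 = 0 \<and>
        (\<forall>n. i n < i (Suc n) \<and> i (Suc n) \<le> i n + length u \<and> inf_prefix u (sdrop (i n) w)))"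
  (is "_ \<longleftrightarrow> ?occurrences")
proof
  assume "quasiperiod u w"
  then obtain p :: "nat \<Rightarrow> 'a list" where "p 0 = []"
    "\<forall>n. length (p n) < length (p (Suc n)) \<and> length (p (Suc n)) \<le> length (p n @ u) \<and>
         inf_prefix (p n @ u) w"
    unfolding quasiperiod_def by blast
  then show ?occurrences
    by (intro exI[of _ "\<lambda>n. length (p n)"]) (simp add: inf_prefix_append_iff)
next
  assume ?occurrences
  then obtain i :: "nat \<Rightarrow> nat" where "i 0 = 0"
    "\<forall>n. i n < i (Suc n) \<and> i (Suc n) \<le> i n + length u \<and> inf_prefix u (sdrop (i n) w)"
    by blast
  then show "quasiperiod u w"
    unfolding quasiperiod_def
    by (intro exI[of _ "\<lambda>n. stake (i n) w"]) (simp add: inf_prefix_iff_stake flip: stake_add)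
qed

lemma quasiperiod_set_subset_sset_sdrop:
  assumes "quasiperiod u w"
  shows "set u \<subseteq> sset (sdrop n w)"
proof -
  obtain i :: "nat \<Rightarrow> nat"
    where mono: "strict_mono i" and occurrence: "inf_prefix u (sdrop (i n) w)"
    using assms unfolding quasiperiod_iff_occurrences strict_mono_Suc_iff by blast
  have "set u \<subseteq> sset (sdrop (i n) w)"
    using occurrence by (auto simp: inf_prefix_def)
  also have "\<dots> = sset (sdrop (i n - n) (sdrop n w))"
    using strict_mono_imp_increasing[OF mono, of n] by simp
  also have "\<dots> \<subseteq> sset (sdrop n w)"
    by (metis stake_sdrop sset_shift Un_upper2)
  finally show ?thesis .
qed

lemma quasiperiod_sset_subset_set:
  assumes "quasiperiod u w"
  shows "sset w \<subseteq> set u"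
proof
  fix a assume "a \<in> sset w"
  then obtain k where k: "a = w !! k"
    by (auto simp: sset_range)
  obtain i :: "nat \<Rightarrow> nat" where zero: "i 0 = 0" and mono: "strict_mono i"
    and step: "\<And>n. i (Suc n) \<le> i n + length u"
    and occurrence: "\<And>n. inf_prefix u (sdrop (i n) w)"
    using assms unfolding quasiperiod_iff_occurrences strict_mono_Suc_iff by blast
  have "k < i (Suc k)"
    using strict_mono_imp_increasing[OF mono, of "Suc k"] by simp
  then obtain n where n: "i n \<le> k" "k < i (Suc n)"
    using ex_least_nat_less[of "\<lambda>n. k < i n" "Suc k"] zero by (auto simp: not_less)
  then have "k - i n < length u"
    using step[of n] by linarith
  moreover have "w !! k = sdrop (i n) w !! (k - i n)"
    using n(1) by (simp add: sdrop_snth)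
  ultimately have "w !! k = u ! (k - i n)"
    using occurrence[of n] by (auto simp: inf_prefix_def)
  then show "a \<in> set u"
    using k \<open>k - i n < length u\<close> by simp
qed

lemma quasiperiodic_recurrent: "quasiperiodic w \<Longrightarrow> sset w \<subseteq> sset (sdrop n w)"
  unfolding quasiperiodic_def
  using quasiperiod_sset_subset_set quasiperiod_set_subset_sset_sdrop by blast

section \<open>Nonerasing morphisms\<close>

locale nonerasing_morphism =
  fixes f :: "'a list \<Rightarrow> 'b list"
  assumes hom_append [simp]: "f (u @ w) = f u @ f w"
    and nonerasing [simp]: "f [a] \<noteq> []"
begin

lemma hom_Nil [simp]: "f [] = []"
  using hom_append[of "[]" "[]"] by simp

lemma hom_Cons: "f (a # u) = f [a] @ f u"
  using hom_append[of "[a]" u] by simp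

lemma length_ge: "length u \<le> length (f u)"
proof (induction u)
  case (Cons a u)
  have "0 < length (f [a])"
    by simp
  with Cons.IH show ?case
    unfolding hom_Cons[of a u] length_append list.size by linarith
qed simp

lemma inf_image_shift: "inf_image f (u @- w) = f u @- inf_image f w"
proof (induction u)
  case (Cons a u)
  have "inf_image f (a ## (u @- w)) = f [a] @- inf_image f (u @- w)"
    unfolding inf_image_def by (subst flat_unfold) simp_all
  then show ?case
    using Cons.IH by (simp add: hom_Cons[of a u])
qed simp

lemma sset_inf_image: "sset (inf_image f w) = (\<Union>a\<in>sset w. set (f [a]))"
  unfolding inf_image_def by (subst sset_flat) (auto simp: stream.set_map)

lemma inf_prefix_inf_image:
  assumes "\<And>u. prefix p (f u @ p)"
  shows "inf_prefix p (inf_image f w)"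
proof -
  let ?u = "stake (length p) w"
  have "length p \<le> length (f ?u)"
    using length_ge[of ?u] by simp
  then have "prefix p (f ?u)"
    using assms[of ?u] by (metis prefix_length_prefix prefixI)
  then obtain s where "f ?u = p @ s"
    by (auto simp: prefix_def)
  moreover have "inf_image f w = f ?u @- inf_image f (sdrop (length p) w)"
    by (metis inf_image_shift stake_sdrop)
  ultimately show ?thesis
    by (auto simp: inf_prefix_def)
qed

lemma quasiperiod_inf_image:
  assumes "\<And>w. w \<in> streams A \<Longrightarrow> inf_prefix u (inf_image f w)"
    and "\<And>a. a \<in> A \<Longrightarrow> length (f [a]) \<le> length u"
    and "w \<in> streams A"
  shows "quasiperiod u (inf_image f w)"
  unfolding quasiperiod_iff_occurrences
proof (intro exI[of _ "\<lambda>n. length (f (stake n w))"] conjI allI)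
  fix n
  have step: "length (f (stake (Suc n) w)) = length (f (stake n w)) + length (f [w !! n])"
    by (simp only: stake_Suc hom_append length_append)
  then show "length (f (stake n w)) < length (f (stake (Suc n) w))"
    by simp
  show "length (f (stake (Suc n) w)) \<le> length (f (stake n w)) + length u"
    using step assms(2,3) by (simp add: streams_iff_snth)
  have "inf_image f w = f (stake n w) @- inf_image f (sdrop n w)"
    by (metis inf_image_shift stake_sdrop)
  then show "inf_prefix u (sdrop (length (f (stake n w))) (inf_image f w))"
    using assms(1)[of "sdrop n w"] assms(3) by (simp add: sdrop_shift streams_iff_snth sdrop_snth)
qed simp

lemma strongly_quasiperiodic_imp_set_subset:
  assumes "strongly_quasiperiodic A f" "a \<in> A" "b \<in> A"
  shows "set (f [a]) \<subseteq> set (f [b])"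
proof -
  let ?w = "[a] @- sconst b"
  have "?w \<in> streams A"
    using assms(2,3) by (simp add: streams_iff_sset)
  then have "quasiperiodic (inf_image f ?w)"
    using assms(1) unfolding strongly_quasiperiodic_def by blast
  then have "sset (inf_image f ?w) \<subseteq> sset (sdrop (length (f [a])) (inf_image f ?w))"
    by (rule quasiperiodic_recurrent)
  then have "set (f [a]) \<subseteq> sset (inf_image f (sconst b))"
    unfolding inf_image_shift by (simp add: sdrop_shift)
  then show ?thesis
    by (simp add: sset_inf_image)
qed

end

lemma nonerasing_morphism_id: "nonerasing_morphism id"
  by unfold_locales simp_all

lemma nonerasing_morphism_comp:
  assumes "nonerasing_morphism f" "nonerasing_morphism g"
  shows "nonerasing_morphism (f \<circ> g)"
proof -
  interpret f: nonerasing_morphism f by fact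
  interpret g: nonerasing_morphism g by fact
  have "(f \<circ> g) [a] \<noteq> []" for a
    using f.length_ge[of "g [a]"] by auto
  then show ?thesis
    by unfold_locales simp_all
qed

lemma L_Cons: "L y (b # u) = (if b = y then [y] else [y, b]) @ L y u"
  by (simp add: L_def)

lemma nonerasing_morphism_L: "nonerasing_morphism (L y)"
  by unfold_locales (simp_all add: L_def)

interpretation L: nonerasing_morphism "L y" for y
  by (rule nonerasing_morphism_L)

interpretation mu: nonerasing_morphism "mu v" for v
  by (induction v) (simp_all only: mu.simps nonerasing_morphism_id nonerasing_morphism_comp
    nonerasing_morphism_L)

lemma set_L_superset: "set u \<subseteq> set (L y u)"
  by (induction u) (auto simp: L_Cons)

lemma set_L_subset: "set (L y u) \<subseteq> insert y (set u)"
  by (induction u) (auto simp: L_Cons)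

lemma set_mu_superset: "set u \<subseteq> set (mu v u)"
  using set_L_superset by (induction v) fastforce+

lemma set_mu_subset: "set (mu v u) \<subseteq> set v \<union> set u"
  using set_L_subset by (induction v) fastforce+

section \<open>Palindromes\<close>

abbreviation palindrome :: "'a list \<Rightarrow> bool" where
  "palindrome p \<equiv> rev p = p"

lemma palindrome_eq_prefix_append:
  assumes "palindrome p" "prefix w p"
  shows "p = w @ rev (take (length p - length w) p)"
proof -
  have "drop (length w) p = rev (take (length p - length w) p)"
    using assms(1) by (metis drop_rev)
  then show ?thesis
    using assms(2) by (auto simp: prefix_def)
qed

lemma short_palindrome_eq_prefix_append:
  assumes "palindrome p" "prefix w p" "length p \<le> 2 * length w"
  shows "p = w @ rev (take (length p - length w) w)"
proof -
  have "take (length p - length w) p = take (length p - length w) w"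
    using assms(2,3) by (auto simp: prefix_def)
  then show ?thesis
    using palindrome_eq_prefix_append[OF assms(1,2)] by simp
qed

lemma short_palindrome_mset_subset:
  assumes "palindrome p" "prefix w p" "length p \<le> 2 * length w"
    and "palindrome q" "prefix w q" "length p \<le> length q"
  shows "mset p \<subseteq># mset q"
proof -
  let ?m = "length p - length w" and ?n = "length q - length w"
  have "take ?m w = take ?m (take ?n q)"
    using assms(3,5,6) by (auto simp: prefix_def)
  then have "mset (take ?m w) \<subseteq># mset (take ?n q)"
    by (metis append_take_drop_id mset_append mset_subset_eq_add_left)
  then have "mset (w @ rev (take ?m w)) \<subseteq># mset (w @ rev (take ?n q))"
    by simp
  then show ?thesis
    using short_palindrome_eq_prefix_append[OF assms(1-3)]
      palindrome_eq_prefix_append[OF assms(4,5)] by metis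
qed

lemma short_palindrome_successively:
  assumes "palindrome p" "prefix w p" "length p < 2 * length w"
    and "successively R w" "symp R"
  shows "successively R p"
proof -
  obtain t where t: "p = w @ t"
    using assms(2) by (auto simp: prefix_def)
  then have "w @ t = rev t @ rev w"
    using assms(1) by simp
  moreover have "length t < length w"
    using assms(3) t by simp
  ultimately obtain z where z: "w = rev t @ z" "rev w = z @ t"
    by (auto simp: append_eq_append_conv2)
  have "z \<noteq> []"
    using z(1) \<open>length t < length w\<close> by auto
  moreover have "successively R (rev w)"
    using assms(4,5) by (auto elim: successively_mono dest: sympD)
  then have "successively R (z @ t)"
    unfolding z(2) .
  ultimately show ?thesis
    using assms(4) unfolding t z(1) by (auto simp: successively_append_iff)
qed

lemma
  shows palindrome_pal_closure: "palindrome (pal_closure w)"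
    and prefix_pal_closure: "prefix w (pal_closure w)"
    and length_pal_closure_le: "palindrome p \<Longrightarrow> prefix w p \<Longrightarrow> length (pal_closure w) \<le> length p"
proof -
  have witness: "palindrome (w @ rev w) \<and> prefix w (w @ rev w)"
    by simp
  note arg_min_nat_lemma[of "\<lambda>p. palindrome p \<and> prefix w p", OF witness, of length]
  then show "palindrome (pal_closure w)" "prefix w (pal_closure w)"
    "palindrome p \<Longrightarrow> prefix w p \<Longrightarrow> length (pal_closure w) \<le> length p"
    unfolding pal_closure_def by blast+
qed

lemma length_pal_closure_snoc_less: "length (pal_closure (u @ [x])) < 2 * length (u @ [x])"
  using length_pal_closure_le[of "u @ [x] @ rev u" "u @ [x]"] by simp

lemma pal_closure_eqI:
  assumes "palindrome p" "prefix w p" "length p \<le> length (pal_closure w)"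
  shows "pal_closure w = p"
proof -
  have "length p = length (pal_closure w)"
    using length_pal_closure_le[OF assms(1,2)] assms(3) by simp
  moreover have "length (pal_closure w) \<le> 2 * length w"
    using length_pal_closure_le[of "w @ rev w" w] by simp
  ultimately show ?thesis
    using short_palindrome_eq_prefix_append[OF assms(1,2)]
      short_palindrome_eq_prefix_append[OF palindrome_pal_closure prefix_pal_closure]
    by metis
qed

section \<open>Justin's formula\<close>

definition delimit :: "'a \<Rightarrow> 'a list \<Rightarrow> 'a list" where
  "delimit y u = L y u @ [y]"

lemma delimit_Nil [simp]: "delimit y [] = [y]"
  by (simp add: delimit_def)

lemma delimit_Cons: "delimit y (b # u) = y # (if b = y then delimit y u else b # delimit y u)"
  by (simp add: delimit_def L_Cons)

lemma delimit_append: "delimit y (u @ w) = L y u @ delimit y w"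
  by (simp add: delimit_def)

lemma delimit_eq_Cons: "\<exists>t. delimit y u = y # t"
  by (cases u) (auto simp: delimit_Cons)

lemma rev_delimit: "rev (delimit y u) = delimit y (rev u)"
proof (induction u)
  case (Cons b u)
  then show ?case
    by (simp add: delimit_Cons delimit_append) (simp add: delimit_def)
qed simp

lemma length_L: "length (L y u) = size (mset u) + size (filter_mset (\<lambda>b. b \<noteq> y) (mset u))"
  by (induction u) (auto simp: L_Cons)

lemma length_delimit_mono: "mset u \<subseteq># mset w \<Longrightarrow> length (delimit y u) \<le> length (delimit y w)"
  unfolding delimit_def length_append length_L
  by (intro add_mono size_mset_mono multiset_filter_mono order_refl)

lemma prefix_delimit_snoc_iff: "prefix (delimit y u @ [x]) (delimit y q) \<longleftrightarrow> prefix (u @ [x]) q"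
proof (induction u arbitrary: q)
  case Nil
  show ?case
  proof (cases q)
    case (Cons c q')
    then show ?thesis
      using delimit_eq_Cons[of y q'] by (auto simp: delimit_Cons)
  qed simp
next
  case (Cons a u)
  show ?case
  proof (cases q)
    case Nil
    then show ?thesis
      by (simp add: delimit_Cons)
  next
    case (Cons c q')
    have "prefix (delimit y (a # u) @ [x]) (delimit y q) \<longleftrightarrow>
        a = c \<and> prefix (delimit y u @ [x]) (delimit y q')"
      using delimit_eq_Cons[of y u] delimit_eq_Cons[of y q']
      by (auto simp: Cons delimit_Cons)
    then show ?thesis
      using Cons.IH[of q'] by (simp add: Cons)
  qed
qed

lemma prefix_delimit_iff: "prefix (delimit y u) (delimit y w) \<longleftrightarrow> prefix u w"
proof
  assume "prefix u w"
  then obtain s where "w = u @ s"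
    by (auto simp: prefix_def)
  then show "prefix (delimit y u) (delimit y w)"
    using delimit_eq_Cons[of y s] by (auto simp: delimit_append) (simp add: delimit_def)
next
  assume delimit: "prefix (delimit y u) (delimit y w)"
  show "prefix u w"
  proof (cases u rule: rev_cases)
    case (snoc u' a)
    have "prefix (delimit y u' @ [a]) (delimit y u)"
      by (simp add: snoc prefix_delimit_snoc_iff)
    then show ?thesis
      using delimit prefix_delimit_snoc_iff snoc by (metis prefix_order.trans)
  qed simp
qed

lemma delimit_inject: "delimit y u = delimit y w \<longleftrightarrow> u = w"
  by (metis prefix_delimit_iff prefix_order.antisym prefix_order.refl)

definition separating :: "'a \<Rightarrow> 'a list \<Rightarrow> bool" where
  "separating y = successively (\<lambda>a b. a = y \<or> b = y)"

lemma separating_delimit_snoc: "separating y (delimit y u @ [x])"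
proof (induction u)
  case (Cons b u)
  then show ?case
    using delimit_eq_Cons[of y u] by (auto simp: delimit_Cons separating_def)
qed (simp add: separating_def)

lemma separating_imp_ex_delimit:
  assumes "separating y q" "q \<noteq> []" "hd q = y" "last q = y"
  shows "\<exists>u. q = delimit y u"
  using assms
proof (induction q rule: induct_list012)
  case (2 a)
  then show ?case
    by (metis delimit_Nil list.sel(1))
next
  case (3 a b q)
  show ?case
  proof (cases "b = y")
    case True
    then obtain u where "b # q = delimit y u"
      using "3.IH"(2) "3.prems" by (auto simp: separating_def)
    then have "a # b # q = delimit y (y # u)"
      using "3.prems"(3) by (simp add: delimit_Cons)
    then show ?thesis ..
  next
    case False
    then obtain u where "q = delimit y u"
      using "3.IH"(1) "3.prems" by (auto simp: separating_def successively_Cons split: if_splits)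
    then have "a # b # q = delimit y (b # u)"
      using "3.prems"(3) False by (simp add: delimit_Cons)
    then show ?thesis ..
  qed
qed simp

lemma ex_delimit_pal_closure:
  "\<exists>q. pal_closure (delimit y u @ [x]) = delimit y q"
proof -
  let ?w = "delimit y u @ [x]"
  let ?p = "pal_closure ?w"
  have "separating y ?p"
    unfolding separating_def
  proof (rule short_palindrome_successively)
    show "length ?p < 2 * length ?w"
      by (rule length_pal_closure_snoc_less)
    show "successively (\<lambda>a b. a = y \<or> b = y) ?w"
      using separating_delimit_snoc[of y u x] by (simp add: separating_def)
  qed (auto simp: palindrome_pal_closure prefix_pal_closure symp_def)
  moreover have p: "?p \<noteq> []" "hd ?p = y"
    using prefix_pal_closure[of ?w] delimit_eq_Cons[of y u] by (auto simp: prefix_def)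
  moreover have "last ?p = y"
    using p palindrome_pal_closure[of ?w] by (metis hd_rev)
  ultimately show ?thesis
    by (intro separating_imp_ex_delimit)
qed

lemma pal_closure_delimit_snoc:
  "pal_closure (delimit y u @ [x]) = delimit y (pal_closure (u @ [x]))"
proof (rule pal_closure_eqI)
  let ?p = "pal_closure (u @ [x])"
  show "palindrome (delimit y ?p)"
    by (simp add: rev_delimit palindrome_pal_closure)
  show "prefix (delimit y u @ [x]) (delimit y ?p)"
    by (simp add: prefix_delimit_snoc_iff prefix_pal_closure)
  obtain q where q: "pal_closure (delimit y u @ [x]) = delimit y q"
    using ex_delimit_pal_closure[of y u x] by blast
  then have "palindrome q"
    using palindrome_pal_closure[of "delimit y u @ [x]"] by (simp add: rev_delimit delimit_inject)
  moreover have "prefix (u @ [x]) q"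
    using prefix_pal_closure[of "delimit y u @ [x]"] by (simp add: q prefix_delimit_snoc_iff)
  ultimately have "mset ?p \<subseteq># mset q"
    using length_pal_closure_snoc_less[of u x]
    by (intro short_palindrome_mset_subset[of ?p "u @ [x]"])
      (auto simp: palindrome_pal_closure prefix_pal_closure length_pal_closure_le)
  \<comment> \<open>Lengths would not do: of two words, the shorter one can have the longer image under \<open>delimit y\<close>.\<close>
  then show "length (delimit y ?p) \<le> length (pal_closure (delimit y u @ [x]))"
    by (simp add: q length_delimit_mono)
qed

lemma Pal_Nil [simp]: "Pal [] = []"
  by (simp add: Pal_def)

lemma Pal_snoc: "Pal (v @ [x]) = pal_closure (Pal v @ [x])"
  by (simp add: Pal_def)

lemma Pal_Cons: "Pal (y # v) = delimit y (Pal v)"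
proof (induction v rule: rev_induct)
  case Nil
  have "pal_closure [y] = [y]"
    using length_pal_closure_le[of "[y]" "[y]"] prefix_length_le[OF prefix_pal_closure[of "[y]"]]
    by (intro pal_closure_eqI) auto
  then show ?case
    using Pal_snoc[of "[]" y] by simp
next
  case (snoc x v)
  then show ?case
    using Pal_snoc[of "y # v" x] by (simp add: Pal_snoc pal_closure_delimit_snoc)
qed

section \<open>Strong quasiperiodicity of epistandard morphisms\<close>

lemma prefix_Pal_mu: "prefix (Pal v) (mu v u @ Pal v)"
proof (induction v)
  case (Cons x v)
  then have "prefix (delimit x (Pal v)) (delimit x (mu v u @ Pal v))"
    by (simp add: prefix_delimit_iff)
  then show ?case
    by (simp add: Pal_Cons delimit_append)
qed simp

lemma mu_fresh_letter: "a \<notin> set v \<Longrightarrow> mu v [a] = Pal v @ [a]"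
  by (induction v) (auto simp: Pal_Cons delimit_def L_Cons)

lemma prefix_mu_letter_Pal:
  assumes "a \<in> set v"
  shows "prefix (mu v [a]) (Pal v)"
  using assms
proof (induction v)
  case (Cons x v)
  show ?case
  proof (cases "a \<in> set v")
    case True
    then obtain s where "Pal v = mu v [a] @ s"
      using Cons.IH by (auto simp: prefix_def)
    then show ?thesis
      by (simp add: Pal_Cons delimit_append)
  next
    case False
    then show ?thesis
      using Cons.prems by (simp add: mu_fresh_letter Pal_Cons delimit_def L_Cons)
  qed
qed simp

lemma quasiperiod_Pal:
  assumes "w \<in> streams (set v)"
  shows "quasiperiod (Pal v) (inf_image (mu v) w)"
  using assms
  by (rule mu.quasiperiod_inf_image[rotated 2])
    (simp_all add: mu.inf_prefix_inf_image prefix_Pal_mu prefix_mu_letter_Pal prefix_length_le)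

lemma strongly_quasiperiodic_mu_imp_subset:
  assumes "strongly_quasiperiodic A (mu v)" "2 \<le> card A"
  shows "A \<subseteq> set v"
proof
  fix a assume a: "a \<in> A"
  have "A \<noteq> {a}"
    using assms(2) by auto
  then obtain b where b: "b \<in> A" "a \<noteq> b"
    using a by blast
  have "a \<in> set (mu v [a])"
    using set_mu_superset[of "[a]" v] by simp
  also have "\<dots> \<subseteq> set (mu v [b])"
    using mu.strongly_quasiperiodic_imp_set_subset assms(1) a b(1) .
  also have "\<dots> \<subseteq> set v \<union> {b}"
    using set_mu_subset[of v "[b]"] by simp
  finally show "a \<in> set v"
    using b(2) by simp
qed

theorem theorem5p1:
  fixes A :: "'a set" and v :: "'a list"
  assumes "finite A" and "2 \<le> card A" and "v \<in> lists A"
  shows "(strongly_quasiperiodic A (mu v) \<longleftrightarrow> set v = A) \<and>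
         (set v = A \<longrightarrow> (\<forall>w\<in>streams A. quasiperiod (Pal v) (inf_image (mu v) w)))"
proof (intro conjI iffI impI ballI)
  show "quasiperiod (Pal v) (inf_image (mu v) w)" if "set v = A" "w \<in> streams A" for w
    using quasiperiod_Pal that by blast
  then show "strongly_quasiperiodic A (mu v)" if "set v = A"
    using that unfolding strongly_quasiperiodic_def quasiperiodic_def by auto
next
  assume "strongly_quasiperiodic A (mu v)"
  then have "A \<subseteq> set v"
    using assms(2) by (rule strongly_quasiperiodic_mu_imp_subset)
  then show "set v = A"
    using assms(3) by auto
qed

end
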